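(* Let $W$ be a finite Coxeter group and $M(W)$ its biHecke monoid. Any $f\in M(W)$ such that $1.f=1$ is contracting for Bruhat order: $w.f\le_B w$ for all $w\in W$.
   Context: $W$ is a finite Coxeter group with simple reflections $(s_i)_{i\in I}$, identity $1$ and length $\ell$; $D_R(w)=\{i:\ell(ws_i)<\ell(w)\}$. The biHecke monoid $M(W)$ is the monoid of functions $W\to W$, acting on the right, generated by $\pi_i,\overline\pi_i$ ($i\in I$), where $w.\pi_i=w$ if $i\in D_R(w)$ and $ws_i$ otherwise; $w.\overline\pi_i=ws_i$ if $i\in D_R(w)$ and $w$ otherwise. Bruhat order: $u\le_B v$ if some reduced word of $u$ is a subword of some reduced word of $v$. *)

theory Defs
  imports "HOL-Algebra.Multiplicative_Group" "HOL-Library.Sublist"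
begin

section \<open>Coxeter groups\<close>

definition word_prod :: "('a, 'c) monoid_scheme \<Rightarrow> ('i \<Rightarrow> 'a) \<Rightarrow> 'i list \<Rightarrow> 'a" where
  "word_prod W s ws = foldr (\<lambda>i x. s i \<otimes>\<^bsub>W\<^esub> x) ws \<one>\<^bsub>W\<^esub>"

text \<open>
  One application of a relation \<open>(i j)^m(i,j) = 1\<close> inside a word over \<open>I\<close>. The case \<open>m i j = 0\<close>
  imposes no relation and stands for \<open>m(i,j) = \<infinity>\<close>; this agrees with \<^term>\<open>group.ord\<close>, which is \<open>0\<close>
  on elements of infinite order.
\<close>

inductive coxeter_step :: "'i set \<Rightarrow> ('i \<Rightarrow> 'i \<Rightarrow> nat) \<Rightarrow> 'i list \<Rightarrow> 'i list \<Rightarrow> bool"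
  for I m where
  "\<lbrakk>i \<in> I; j \<in> I; set us \<subseteq> I; set vs \<subseteq> I\<rbrakk>
    \<Longrightarrow> coxeter_step I m (us @ concat (replicate (m i j) [i, j]) @ vs) (us @ vs)"

text \<open>
  \<open>(W, (s\<^sub>i)\<^sub>i\<^sub>\<in>\<^sub>I)\<close> is a Coxeter system: \<open>W\<close> is presented by the pairwise distinct involutions \<open>s\<^sub>i\<close>
  subject to \<open>(s\<^sub>i s\<^sub>j)^m(i,j) = 1\<close>, where \<open>m(i,j)\<close> is the order of \<open>s\<^sub>i s\<^sub>j\<close>. Since the relations with
  \<open>i = j\<close> make every generator self-inverse, the group presented in this way is the free monoid on
  \<open>I\<close> modulo the congruence generated by the relations.
\<close>

locale coxeter_system = group W for W (structure) +
  fixes I :: "'i set" and s :: "'i \<Rightarrow> 'a"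
  assumes s_closed: "i \<in> I \<Longrightarrow> s i \<in> carrier W"
    and s_inj: "inj_on s I"
    and s_ord: "i \<in> I \<Longrightarrow> ord (s i) = 2"
    and s_generate: "w \<in> carrier W \<Longrightarrow> \<exists>ws. set ws \<subseteq> I \<and> word_prod W s ws = w"
    and s_presentation: "\<lbrakk>set us \<subseteq> I; set vs \<subseteq> I; word_prod W s us = word_prod W s vs\<rbrakk>
      \<Longrightarrow> equivclp (coxeter_step I (\<lambda>i j. ord (s i \<otimes> s j))) us vs"

locale finite_coxeter_system = coxeter_system +
  assumes finite_carrier: "finite (carrier W)"

definition cox_length :: "('a, 'c) monoid_scheme \<Rightarrow> 'i set \<Rightarrow> ('i \<Rightarrow> 'a) \<Rightarrow> 'a \<Rightarrow> nat" where
  "cox_length W I s w = (LEAST n. \<exists>ws. set ws \<subseteq> I \<and> word_prod W s ws = w \<and> length ws = n)"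

definition reduced_word ::
  "('a, 'c) monoid_scheme \<Rightarrow> 'i set \<Rightarrow> ('i \<Rightarrow> 'a) \<Rightarrow> 'a \<Rightarrow> 'i list \<Rightarrow> bool" where
  "reduced_word W I s w ws \<longleftrightarrow>
    set ws \<subseteq> I \<and> word_prod W s ws = w \<and> length ws = cox_length W I s w"

definition right_descents ::
  "('a, 'c) monoid_scheme \<Rightarrow> 'i set \<Rightarrow> ('i \<Rightarrow> 'a) \<Rightarrow> 'a \<Rightarrow> 'i set" where
  "right_descents W I s w = {i \<in> I. cox_length W I s (w \<otimes>\<^bsub>W\<^esub> s i) < cox_length W I s w}"

text \<open>Subwords need not be contiguous.\<close>

definition bruhat_le ::
  "('a, 'c) monoid_scheme \<Rightarrow> 'i set \<Rightarrow> ('i \<Rightarrow> 'a) \<Rightarrow> 'a \<Rightarrow> 'a \<Rightarrow> bool" where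
  "bruhat_le W I s u v \<longleftrightarrow>
    (\<exists>us vs. reduced_word W I s u us \<and> reduced_word W I s v vs \<and> subseq us vs)"


section \<open>The biHecke monoid\<close>

text \<open>
  Functions act on the right: \<open>w.f\<close> is \<^term>\<open>f w\<close>, and in a product \<open>f g\<close> the function \<open>f\<close> is applied first.
\<close>

definition transformation_monoid :: "'a set \<Rightarrow> ('a \<Rightarrow> 'a) monoid" where
  "transformation_monoid X =
    \<lparr>carrier = X \<rightarrow>\<^sub>E X, mult = \<lambda>f g. compose X g f, one = \<lambda>x\<in>X. x\<rparr>"

inductive_set submonoid_generated :: "('a, 'c) monoid_scheme \<Rightarrow> 'a set \<Rightarrow> 'a set"
  for G A where
  one: "\<one>\<^bsub>G\<^esub> \<in> submonoid_generated G A"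
| incl: "x \<in> A \<Longrightarrow> x \<in> submonoid_generated G A"
| mult: "\<lbrakk>x \<in> submonoid_generated G A; y \<in> submonoid_generated G A\<rbrakk>
    \<Longrightarrow> x \<otimes>\<^bsub>G\<^esub> y \<in> submonoid_generated G A"

definition hecke_pi ::
  "('a, 'c) monoid_scheme \<Rightarrow> 'i set \<Rightarrow> ('i \<Rightarrow> 'a) \<Rightarrow> 'i \<Rightarrow> 'a \<Rightarrow> 'a" where
  "hecke_pi W I s i =
    (\<lambda>w\<in>carrier W. if i \<in> right_descents W I s w then w else w \<otimes>\<^bsub>W\<^esub> s i)"

definition hecke_pi_bar ::
  "('a, 'c) monoid_scheme \<Rightarrow> 'i set \<Rightarrow> ('i \<Rightarrow> 'a) \<Rightarrow> 'i \<Rightarrow> 'a \<Rightarrow> 'a" where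
  "hecke_pi_bar W I s i =
    (\<lambda>w\<in>carrier W. if i \<in> right_descents W I s w then w \<otimes>\<^bsub>W\<^esub> s i else w)"

definition bihecke_monoid ::
  "('a, 'c) monoid_scheme \<Rightarrow> 'i set \<Rightarrow> ('i \<Rightarrow> 'a) \<Rightarrow> ('a \<Rightarrow> 'a) set" where
  "bihecke_monoid W I s =
    submonoid_generated (transformation_monoid (carrier W))
      (hecke_pi W I s ` I \<union> hecke_pi_bar W I s ` I)"

end

theory Submission
  imports Defs
begin

text \<open>
  Every \<open>f\<close> in the biHecke monoid is compatible with left multiplication by a simple reflection: for
  all \<open>w\<close> and \<open>j\<close>, the value \<open>(s\<^sub>j w).f\<close> is either \<open>w.f\<close> or \<open>s\<^sub>j (w.f)\<close> (\<open>bihecke_left_mult\<close>). This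
  property passes to products, so only the generators matter. A generator with index \<open>i\<close> multiplies
  \<open>w\<close> and \<open>s\<^sub>j w\<close> on the right by the same element, unless \<open>i\<close> is a right descent of exactly one of
  the two. But then \<open>s\<^sub>j w = w s\<^sub>i\<close> (\<open>right_descents_left_mult\<close>), and the generator sends both elements
  to the same one, since it sends each pair \<open>{w, w s\<^sub>i}\<close> to a single element.

  Now let \<open>1.f = 1\<close> and let \<open>j\<^sub>1 \<dots> j\<^sub>k\<close> be a reduced word of \<open>w\<close>. Starting from \<open>1.f = 1\<close> and attaching
  the letters \<open>j\<^sub>k, \<dots>, j\<^sub>1\<close> on the left, each step keeps the current value of \<open>f\<close> or multiplies it by
  the attached reflection. So \<open>w.f\<close> is the product of a subword of \<open>j\<^sub>1 \<dots> j\<^sub>k\<close>, and the exchange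
  condition lets this subword be kept reduced at every step (\<open>image_of_word_subword\<close>). This is
  the Bruhat relation by its very definition.

  The one fact needed about Coxeter groups is thus the left exchange condition (\<open>exchange\<close>). It comes
  out of the presentation: attach to a word \<open>i\<^sub>1 \<dots> i\<^sub>k\<close> the reflections
  \<open>s\<^sub>i\<^sub>1 \<dots> s\<^sub>i\<^sub>p \<dots> s\<^sub>i\<^sub>1\<close>, \<open>p = 1, \<dots>, k\<close>. How often a given element occurs among them, modulo 2, does not
  change under the defining relations (\<open>even_count_reflections_eq\<close>), and multiplying the product of
  the word by one of these reflections deletes the corresponding letter
  (\<open>reflection_deletes_letter\<close>).
\<close>

context coxeter_system
begin

section \<open>Words and their products\<close>

abbreviation wp :: "'i list \<Rightarrow> 'a" where
  "wp \<equiv> word_prod W s"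

abbreviation len :: "'a \<Rightarrow> nat" where
  "len \<equiv> cox_length W I s"

lemma word_prod_Nil [simp]: "wp [] = \<one>"
  and word_prod_Cons [simp]: "wp (i # ws) = s i \<otimes> wp ws"
  by (simp_all add: word_prod_def)

lemma word_prod_closed [simp]: "set ws \<subseteq> I \<Longrightarrow> wp ws \<in> carrier W"
  by (induction ws) (auto simp: s_closed)

lemma word_prod_append:
  "set us \<subseteq> I \<Longrightarrow> set vs \<subseteq> I \<Longrightarrow> wp (us @ vs) = wp us \<otimes> wp vs"
  by (induction us) (auto simp: s_closed m_assoc)

lemma s_square: "i \<in> I \<Longrightarrow> s i \<otimes> s i = \<one>"
  using pow_ord_eq_1[of "s i"] s_closed s_ord by (simp add: numeral_2_eq_2)

lemma s_cancel: "i \<in> I \<Longrightarrow> x \<in> carrier W \<Longrightarrow> s i \<otimes> (s i \<otimes> x) = x"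
  by (simp add: s_closed s_square flip: m_assoc)

lemma s_cancel_right: "i \<in> I \<Longrightarrow> x \<in> carrier W \<Longrightarrow> x \<otimes> s i \<otimes> s i = x"
  by (simp add: s_closed s_square m_assoc)

lemma inv_s: "i \<in> I \<Longrightarrow> inv (s i) = s i"
  by (simp add: inv_equality s_closed s_square)


section \<open>The length function\<close>

lemma len_le: "set ws \<subseteq> I \<Longrightarrow> len (wp ws) \<le> length ws"
  unfolding cox_length_def by (rule Least_le) auto

lemma obtain_reduced:
  assumes "w \<in> carrier W"
  obtains ws where "set ws \<subseteq> I" "wp ws = w" "length ws = len w"
proof -
  obtain vs where "set vs \<subseteq> I" "wp vs = w"
    using s_generate[OF assms] by blast
  then have "\<exists>n ws. set ws \<subseteq> I \<and> wp ws = w \<and> length ws = n"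
    by blast
  from LeastI_ex[OF this] show thesis
    using that unfolding cox_length_def by blast
qed

text \<open>
  The form in which the presentation is used: a function of words that is unchanged by each defining
  relation is in fact a function of the group element.
\<close>

lemma word_invariant:
  assumes step: "\<And>us vs. coxeter_step I (\<lambda>i j. ord (s i \<otimes> s j)) us vs \<Longrightarrow> F us = F vs"
    and "set us \<subseteq> I" "set vs \<subseteq> I" "wp us = wp vs"
  shows "F us = F vs"
  using s_presentation[OF assms(2-4)]
  by (induction rule: equivclp_induct) (auto dest: step)

text \<open>
  Each defining relation has even length \<open>2 m(i,j)\<close>. Hence multiplication by a simple reflection always
  changes the length, and a non-descent is an ascent.
\<close>

lemma even_length_eq:
  assumes "set us \<subseteq> I" "set vs \<subseteq> I" "wp us = wp vs"
  shows "even (length us) = even (length vs)"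
  by (rule word_invariant[OF _ assms])
    (auto elim!: coxeter_step.cases simp: length_concat sum_list_replicate)

lemma len_s_mult_le:
  assumes "i \<in> I" "w \<in> carrier W"
  shows "len (s i \<otimes> w) \<le> Suc (len w)"
proof -
  obtain ws where ws: "set ws \<subseteq> I" "wp ws = w" "length ws = len w"
    using obtain_reduced assms(2) by blast
  then show ?thesis
    using len_le[of "i # ws"] assms(1) by simp
qed

lemma len_mult_s_le:
  assumes "i \<in> I" "w \<in> carrier W"
  shows "len (w \<otimes> s i) \<le> Suc (len w)"
proof -
  obtain ws where ws: "set ws \<subseteq> I" "wp ws = w" "length ws = len w"
    using obtain_reduced assms(2) by blast
  then show ?thesis
    using len_le[of "ws @ [i]"] assms(1) by (simp add: word_prod_append s_closed)
qed

lemma len_s_mult_neq: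
  assumes "i \<in> I" "w \<in> carrier W"
  shows "len (s i \<otimes> w) \<noteq> len w"
proof -
  obtain ws where ws: "set ws \<subseteq> I" "wp ws = w" "length ws = len w"
    using obtain_reduced assms(2) by blast
  obtain vs where vs: "set vs \<subseteq> I" "wp vs = s i \<otimes> w" "length vs = len (s i \<otimes> w)"
    using obtain_reduced[OF m_closed[OF s_closed[OF assms(1)] assms(2)]] by blast
  show ?thesis
    using even_length_eq[of "i # ws" vs] ws vs assms(1) by auto
qed

lemma len_mult_s_neq:
  assumes "i \<in> I" "w \<in> carrier W"
  shows "len (w \<otimes> s i) \<noteq> len w"
proof -
  obtain ws where ws: "set ws \<subseteq> I" "wp ws = w" "length ws = len w"
    using obtain_reduced assms(2) by blast
  obtain vs where vs: "set vs \<subseteq> I" "wp vs = w \<otimes> s i" "length vs = len (w \<otimes> s i)"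
    using obtain_reduced[OF m_closed[OF assms(2) s_closed[OF assms(1)]]] by blast
  show ?thesis
    using even_length_eq[of "ws @ [i]" vs] ws vs assms(1)
    by (auto simp: word_prod_append s_closed)
qed

lemma len_s_mult_cases:
  assumes "i \<in> I" "w \<in> carrier W"
  obtains "len (s i \<otimes> w) = Suc (len w)" | "len w = Suc (len (s i \<otimes> w))"
proof -
  have "len w \<le> Suc (len (s i \<otimes> w))"
    using len_s_mult_le[of i "s i \<otimes> w"] assms by (simp add: s_cancel s_closed)
  then show thesis
    using that len_s_mult_le[OF assms] len_s_mult_neq[OF assms] by linarith
qed

lemma len_mult_s_cases:
  assumes "i \<in> I" "w \<in> carrier W"
  obtains "len (w \<otimes> s i) = Suc (len w)" | "len w = Suc (len (w \<otimes> s i))"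
proof -
  have "len w \<le> Suc (len (w \<otimes> s i))"
    using len_mult_s_le[of i "w \<otimes> s i"] assms by (simp add: s_cancel_right s_closed)
  then show thesis
    using that len_mult_s_le[OF assms] len_mult_s_neq[OF assms] by linarith
qed


section \<open>The exchange condition\<close>

text \<open>
  The list of the \<open>s\<^sub>i\<^sub>1 \<dots> s\<^sub>i\<^sub>p \<dots> s\<^sub>i\<^sub>1\<close> in the order \<open>p = 1, \<dots>, k\<close>, with repetitions kept.
\<close>

primrec reflections :: "'i list \<Rightarrow> 'a list" where
  "reflections [] = []"
| "reflections (i # ws) = s i # map (\<lambda>t. s i \<otimes> t \<otimes> s i) (reflections ws)"

lemma reflections_closed: "set ws \<subseteq> I \<Longrightarrow> set (reflections ws) \<subseteq> carrier W"
  by (induction ws) (auto simp: s_closed)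

lemma length_reflections [simp]: "length (reflections ws) = length ws"
  by (induction ws) auto

lemma reflections_append:
  assumes "set us \<subseteq> I" "set vs \<subseteq> I"
  shows "reflections (us @ vs)
    = reflections us @ map (\<lambda>t. wp us \<otimes> t \<otimes> inv (wp us)) (reflections vs)"
  using assms(1)
proof (induction us)
  case Nil
  have "map (\<lambda>t. wp [] \<otimes> t \<otimes> inv (wp [])) (reflections vs) = reflections vs"
    using reflections_closed[OF assms(2)] by (intro map_idI) auto
  then show ?case by simp
next
  case (Cons i us)
  then show ?case
    using reflections_closed[OF assms(2)]
    by (auto simp: inv_mult_group inv_s s_closed m_assoc subset_iff)
qed

text \<open>
  Because \<open>s\<^sub>i\<close> and \<open>s\<^sub>j\<close> are involutions, the palindrome \<open>s\<^sub>i s\<^sub>j s\<^sub>i \<dots> s\<^sub>i\<close> with \<open>2 p + 1\<close> factors is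
  \<open>(s\<^sub>i s\<^sub>j)\<^sup>p s\<^sub>i\<close>.
\<close>

lemma reflections_alternating:
  assumes "i \<in> I" "j \<in> I"
  shows "reflections (concat (replicate n [i, j]))
    = map (\<lambda>p. (s i \<otimes> s j) [^] p \<otimes> s i) [0..<2 * n]"
proof (induction n)
  case 0
  show ?case by simp
next
  case (Suc n)
  let ?a = "s i \<otimes> s j"
  have cl: "s i \<in> carrier W" "s j \<in> carrier W"
    using assms s_closed by auto
  have conj: "s i \<otimes> (s j \<otimes> (?a [^] p \<otimes> s i) \<otimes> s j) \<otimes> s i = ?a [^] Suc (Suc p) \<otimes> s i" for p :: nat
  proof -
    have "s i \<otimes> (s j \<otimes> (?a [^] p \<otimes> s i) \<otimes> s j) \<otimes> s i = ?a \<otimes> ?a [^] p \<otimes> ?a \<otimes> s i"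
      using cl by (simp add: m_assoc)
    also have "?a \<otimes> ?a [^] p = ?a [^] Suc p"
      using cl nat_pow_Suc2 by simp
    finally show ?thesis using cl by simp
  qed
  have "[0..<2 * Suc n] = 0 # 1 # map (\<lambda>p. Suc (Suc p)) [0..<2 * n]"
    by (simp add: upt_conv_Cons map_Suc_upt map_map[symmetric, unfolded comp_def] del: upt_Suc map_map)
  then show ?case
    using Suc cl conj by (simp add: m_assoc o_def)
qed

text \<open>
  The reflections of a defining relation form a list of length \<open>2 m(i,j)\<close> that is periodic with period
  \<open>m(i,j)\<close>, the order of \<open>s\<^sub>i s\<^sub>j\<close>; so every element occurs an even number of times. The argument also
  covers \<open>m(i,j) = 0\<close>, where the list is empty.
\<close>

lemma even_count_reflections_relation:
  assumes "i \<in> I" "j \<in> I"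
  shows "even (count_list (reflections (concat (replicate (ord (s i \<otimes> s j)) [i, j]))) t)"
proof -
  let ?a = "s i \<otimes> s j"
  let ?f = "\<lambda>p. ?a [^] p \<otimes> s i"
  let ?m = "ord ?a"
  have a: "?a \<in> carrier W"
    using assms s_closed by auto
  have "[0..<2 * ?m] = [0..<?m] @ map (\<lambda>p. p + ?m) [0..<?m]"
    using upt_add_eq_append[of 0 ?m ?m] by (simp add: map_add_upt mult_2)
  moreover have "?f (p + ?m) = ?f p" for p
    using a by (simp add: nat_pow_mult[symmetric] pow_ord_eq_1)
  ultimately have "map ?f [0..<2 * ?m] = map ?f [0..<?m] @ map ?f [0..<?m]"
    by (simp add: o_def)
  then show ?thesis
    by (simp add: reflections_alternating[OF assms])
qed

lemma count_list_map_inj_on: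
  assumes "inj_on g A" "set xs \<subseteq> A" "x \<in> A"
  shows "count_list (map g xs) (g x) = count_list xs x"
  using assms(2) by (induction xs) (auto simp: inj_on_eq_iff[OF assms(1) _ assms(3)])

lemma even_count_list_map:
  assumes "\<And>t. even (count_list xs t)" "inj_on g (set xs)"
  shows "even (count_list (map g xs) t)"
proof (cases "t \<in> g ` set xs")
  case True
  then obtain x where "x \<in> set xs" "t = g x" by auto
  then show ?thesis
    using count_list_map_inj_on[OF assms(2) subset_refl] assms(1) by simp
next
  case False
  then show ?thesis by (simp add: count_list_0_iff)
qed

text \<open>
  Inserting a defining relation into a word inserts conjugates of the reflections of the relation,
  which come in equal pairs, and leaves all other reflections as they were because the relation
  has product \<open>1\<close>.
\<close>

lemma even_count_reflections_eq:
  assumes "set us \<subseteq> I" "set vs \<subseteq> I" "wp us = wp vs"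
  shows "even (count_list (reflections us) t) = even (count_list (reflections vs) t)"
proof (rule word_invariant[OF _ assms])
  fix xs ys assume "coxeter_step I (\<lambda>i j. ord (s i \<otimes> s j)) xs ys"
  then show "even (count_list (reflections xs) t) = even (count_list (reflections ys) t)"
  proof cases
    case (1 i j us vs)
    define r where "r = concat (replicate (ord (s i \<otimes> s j)) [i, j])"
    have r: "set r \<subseteq> I"
      using 1 by (auto simp: r_def)
    have "wp (concat (replicate n [i, j])) = (s i \<otimes> s j) [^] n" for n :: nat
    proof (induction n)
      case (Suc n)
      then show ?case
        using 1 nat_pow_Suc2[of "s i \<otimes> s j" n] by (simp add: s_closed m_assoc)
    qed simp
    then have r1: "wp r = \<one>"
      using 1 by (simp add: r_def s_closed pow_ord_eq_1)
    have inj: "inj_on (\<lambda>t. wp us \<otimes> t \<otimes> inv (wp us)) (set (reflections r))"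
      using reflections_closed[OF r] 1 by (auto intro!: inj_onI simp: subset_iff)
    have "even (count_list (map (\<lambda>t. wp us \<otimes> t \<otimes> inv (wp us)) (reflections r)) t)"
      by (rule even_count_list_map[OF _ inj])
        (use 1 even_count_reflections_relation in \<open>simp add: r_def\<close>)
    moreover have "reflections (r @ vs) = reflections r @ reflections vs"
    proof -
      have "map (\<lambda>t. wp r \<otimes> t \<otimes> inv (wp r)) (reflections vs) = reflections vs"
        using reflections_closed[OF 1(6)] r1 by (intro map_idI) auto
      then show ?thesis
        using reflections_append[OF r 1(6)] by simp
    qed
    ultimately show ?thesis
      using 1 r by (simp add: reflections_append flip: r_def)
  qed
qed

text \<open>
  With \<open>t = s\<^sub>i\<^sub>1 \<dots> s\<^sub>i\<^sub>p \<dots> s\<^sub>i\<^sub>1\<close>, everything up to the letter \<open>i\<^sub>p\<close> in \<open>s\<^sub>i\<^sub>1 \<dots> s\<^sub>i\<^sub>k\<close> cancels against \<open>t\<close>,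
  except for the prefix \<open>s\<^sub>i\<^sub>1 \<dots> s\<^sub>i\<^sub>p\<^sub>-\<^sub>1\<close>.
\<close>

lemma reflection_deletes_letter:
  assumes "set ws \<subseteq> I" "t \<in> set (reflections ws)"
  shows "\<exists>us i vs. ws = us @ i # vs \<and> t \<otimes> wp ws = wp (us @ vs)"
  using assms
proof (induction ws arbitrary: t)
  case (Cons i ws)
  consider "t = s i" | t' where "t' \<in> set (reflections ws)" "t = s i \<otimes> t' \<otimes> s i"
    using Cons.prems by auto
  then show ?case
  proof cases
    case 1
    then have "i # ws = [] @ i # ws \<and> t \<otimes> wp (i # ws) = wp ([] @ ws)"
      using Cons.prems(1) by (simp add: s_cancel)
    then show ?thesis by blast
  next
    case 2
    obtain us k vs where *: "ws = us @ k # vs" "t' \<otimes> wp ws = wp (us @ vs)"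
      using Cons.IH[OF _ 2(1)] Cons.prems(1) by auto
    have "t' \<in> carrier W"
      using 2 reflections_closed[of ws] Cons.prems(1) by auto
    then have "t \<otimes> wp (i # ws) = s i \<otimes> (t' \<otimes> wp ws)"
      using 2 Cons.prems by (simp add: m_assoc s_closed s_cancel)
    then have "i # ws = (i # us) @ k # vs \<and> t \<otimes> wp (i # ws) = wp ((i # us) @ vs)"
      using * by simp
    then show ?thesis by blast
  qed
qed simp

text \<open>
  Put the letter \<open>i\<close> in front of a reduced word \<open>vs\<close> of the shorter element. The result is another word
  for the product of \<open>ws\<close>, in whose reflections \<open>s i\<close> occurs exactly once: a second occurrence would
  make \<open>s i\<close> a reflection of \<open>vs\<close> and so allow a letter of \<open>vs\<close> to be deleted, giving a word that is
  too short. By parity \<open>s i\<close> is a reflection of \<open>ws\<close> as well, so it deletes a letter there.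
\<close>

lemma exchange:
  assumes ws: "set ws \<subseteq> I" "length ws = len (wp ws)"
    and i: "i \<in> I" and less: "len (s i \<otimes> wp ws) < len (wp ws)"
  obtains us k vs where "ws = us @ k # vs" "s i \<otimes> wp ws = wp (us @ vs)"
proof -
  obtain vs where vs: "set vs \<subseteq> I" "wp vs = s i \<otimes> wp ws" "length vs = len (s i \<otimes> wp ws)"
    using obtain_reduced[OF m_closed[OF s_closed[OF i] word_prod_closed[OF ws(1)]]] by blast
  have eq: "wp (i # vs) = wp ws"
    using vs i ws by (simp add: s_cancel)
  \<comment> \<open>The first reflection of \<open>i # vs\<close> is \<open>s i\<close>; the others are those of \<open>vs\<close>, conjugated.\<close>
  have "s i \<notin> set (map (\<lambda>t. s i \<otimes> t \<otimes> s i) (reflections vs))"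
  proof
    assume "s i \<in> set (map (\<lambda>t. s i \<otimes> t \<otimes> s i) (reflections vs))"
    then obtain t where t: "t \<in> set (reflections vs)" "s i = s i \<otimes> t \<otimes> s i"
      by auto
    have tc: "t \<in> carrier W"
      using t reflections_closed vs by auto
    have "t = s i \<otimes> (s i \<otimes> t \<otimes> s i) \<otimes> s i"
      using tc i by (simp add: m_assoc s_closed s_cancel s_square)
    also have "\<dots> = s i"
      using i by (simp add: s_closed s_square flip: t(2))
    finally have "s i \<in> set (reflections vs)" using t by simp
    then obtain as k bs where *: "vs = as @ k # bs" "s i \<otimes> wp vs = wp (as @ bs)"
      using reflection_deletes_letter[OF vs(1)] by metis
    have "wp (as @ bs) = wp ws" using * eq by simp
    then have "len (wp ws) \<le> length (as @ bs)"
      using len_le[of "as @ bs"] * vs(1) by auto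
    then show False using * vs less by simp
  qed
  then have "count_list (reflections (i # vs)) (s i) = 1"
    by (simp add: count_list_0_iff)
  then have "odd (count_list (reflections ws) (s i))"
    using even_count_reflections_eq[of "i # vs" ws "s i"] eq vs i ws by simp
  then have "s i \<in> set (reflections ws)"
    by (metis count_list_0_iff even_zero)
  then show thesis
    using reflection_deletes_letter[OF ws(1)] that by metis
qed

text \<open>
  The lengths force \<open>s j\<close> to lengthen \<open>w\<close> and to shorten \<open>w \<otimes> s i\<close>. Exchange \<open>s j\<close> into a reduced word of
  \<open>w \<otimes> s i\<close> that ends in \<open>i\<close>. If the deleted letter is this last one, the claim follows. If it lay
  further to the left, \<open>s j \<otimes> w\<close> would be a subword product shorter than \<open>w\<close>.
\<close>

lemma descent_created_by_left_factor:
  assumes w: "w \<in> carrier W" and i: "i \<in> I" and j: "j \<in> I"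
    and up: "len w < len (w \<otimes> s i)"
    and down: "len (s j \<otimes> w \<otimes> s i) < len (s j \<otimes> w)"
  shows "s j \<otimes> w = w \<otimes> s i"
proof -
  have cl: "s i \<in> carrier W" "s j \<in> carrier W"
    using i j s_closed by auto
  have wi: "len (w \<otimes> s i) = Suc (len w)"
    using up by (rule_tac len_mult_s_cases[OF i w]) auto
  have jwi: "len (s j \<otimes> w) = Suc (len (s j \<otimes> w \<otimes> s i))"
    using down by (rule_tac len_mult_s_cases[OF i, of "s j \<otimes> w"]) (use cl w in auto)
  have "len (s j \<otimes> (s j \<otimes> w \<otimes> s i)) \<le> Suc (len (s j \<otimes> w \<otimes> s i))"
    using len_s_mult_le[OF j] cl w by simp
  then have "len (w \<otimes> s i) \<le> len (s j \<otimes> w)"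
    using jwi cl w j by (simp add: m_assoc s_cancel)
  then have jw: "len (s j \<otimes> w) = Suc (len w)"
    using wi len_s_mult_le[OF j w] by simp
  obtain ws where ws: "set ws \<subseteq> I" "wp ws = w" "length ws = len w"
    using obtain_reduced w by blast
  have wsi: "wp (ws @ [i]) = w \<otimes> s i"
    using ws i cl by (simp add: word_prod_append)
  obtain us k vs where *: "ws @ [i] = us @ k # vs" "s j \<otimes> wp (ws @ [i]) = wp (us @ vs)"
  proof (rule exchange[of "ws @ [i]" j])
    show "len (s j \<otimes> wp (ws @ [i])) < len (wp (ws @ [i]))"
      using jwi jw wi wsi cl w by (simp add: m_assoc)
  qed (use ws i j wi wsi in auto)
  show ?thesis
  proof (cases vs rule: rev_cases)
    case Nil
    then have "s j \<otimes> (w \<otimes> s i) = w"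
      using * ws wsi by simp
    then show ?thesis
      using s_cancel[OF j, of "w \<otimes> s i"] cl w by simp
  next
    case (snoc bs b)
    then have ws': "ws = us @ k # bs" and b: "b = i"
      using * by auto
    have ub: "set (us @ bs) \<subseteq> I" using ws ws' by auto
    have "s j \<otimes> w \<otimes> s i = wp (us @ bs) \<otimes> s i"
      using * wsi snoc b word_prod_append[OF ub, of "[i]"] i cl w by (simp add: m_assoc)
    then have "s j \<otimes> w = wp (us @ bs)"
      using cl w word_prod_closed[OF ub] by simp
    then have "len (s j \<otimes> w) < len w"
      using len_le[OF ub] ws ws' by simp
    then show ?thesis using jw by simp
  qed
qed

text \<open>
  The preceding lemma applies to \<open>w\<close> and to \<open>s j \<otimes> w\<close>, according to which of the two has \<open>i\<close> as an
  ascent.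
\<close>

lemma right_descents_left_mult:
  assumes w: "w \<in> carrier W" and i: "i \<in> I" and j: "j \<in> I"
    and neq: "s j \<otimes> w \<noteq> w \<otimes> s i"
  shows "i \<in> right_descents W I s (s j \<otimes> w) \<longleftrightarrow> i \<in> right_descents W I s w"
proof -
  have cl: "s i \<in> carrier W" "s j \<in> carrier W"
    using i j s_closed by auto
  have "s j \<otimes> (s j \<otimes> w) \<noteq> s j \<otimes> w \<otimes> s i"
    using neq cl w by (simp add: m_assoc)
  then show ?thesis
    using descent_created_by_left_factor[OF w i j]
      descent_created_by_left_factor[of "s j \<otimes> w" i j]
      len_mult_s_neq[OF i w] len_mult_s_neq[OF i, of "s j \<otimes> w"] neq cl w i j
    by (auto simp: right_descents_def s_cancel nat_neq_iff)
qed


section \<open>The biHecke monoid and left multiplication\<close>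

text \<open>
  The condition survives composition: when \<open>f\<close> identifies \<open>w\<close> and \<open>s j \<otimes> w\<close>, so does everything applied
  after it, and otherwise the next factor meets a pair of the same kind, \<open>f w\<close> and \<open>s j \<otimes> f w\<close>.
\<close>

lemma bihecke_left_mult:
  assumes "f \<in> bihecke_monoid W I s"
  shows "f \<in> carrier W \<rightarrow> carrier W \<and>
    (\<forall>w\<in>carrier W. \<forall>j\<in>I. f (s j \<otimes> w) \<in> {f w, s j \<otimes> f w})"
  using assms unfolding bihecke_monoid_def
proof (induction rule: submonoid_generated.induct)
  case one
  then show ?case
    by (auto simp: transformation_monoid_def s_closed)
next
  case (incl f)
  then obtain i where i: "i \<in> I" and f: "f = hecke_pi W I s i \<or> f = hecke_pi_bar W I s i"
    by auto
  have closed: "f \<in> carrier W \<rightarrow> carrier W"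
    using f i s_closed by (auto simp: hecke_pi_def hecke_pi_bar_def)
  have "f (s j \<otimes> w) \<in> {f w, s j \<otimes> f w}" if w: "w \<in> carrier W" and j: "j \<in> I" for w j
  proof (cases "s j \<otimes> w = w \<otimes> s i")
    case True
    \<comment> \<open>Both elements of \<open>{w, w \<otimes> s i}\<close> go to the longer one, or both to the shorter one.\<close>
    have "w \<otimes> s i \<otimes> s i = w"
      using w i by (rule_tac s_cancel_right)
    then have "i \<in> right_descents W I s (w \<otimes> s i) \<longleftrightarrow> i \<notin> right_descents W I s w"
      using len_mult_s_neq[OF i w] i by (auto simp: right_descents_def)
    then show ?thesis
      using f w i \<open>w \<otimes> s i \<otimes> s i = w\<close> s_closed True
      by (auto simp: hecke_pi_def hecke_pi_bar_def)
  next
    case False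
    then show ?thesis
      using f w i j s_closed right_descents_left_mult[OF w i j False]
      by (auto simp: hecke_pi_def hecke_pi_bar_def m_assoc)
  qed
  with closed show ?case by blast
next
  case (mult f g)
  have "g (f (s j \<otimes> w)) \<in> {g (f w), s j \<otimes> g (f w)}"
    if "w \<in> carrier W" "j \<in> I" for w j
  proof -
    have "f w \<in> carrier W" "f (s j \<otimes> w) = f w \<or> f (s j \<otimes> w) = s j \<otimes> f w"
      using mult.IH(1) that by auto
    moreover have "g (s j \<otimes> f w) \<in> {g (f w), s j \<otimes> g (f w)}"
      using mult.IH(2) that(2) \<open>f w \<in> carrier W\<close> by blast
    ultimately show ?thesis by auto
  qed
  then show ?case
    using mult.IH s_closed by (auto simp: transformation_monoid_def compose_def Pi_iff)
qed

text \<open>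
  The word \<open>ws\<close> is arbitrary here. When the attached reflection shortens the current image, the
  exchange condition expresses the new image by deleting a letter from the reduced subword at hand,
  rather than by adding one.
\<close>

lemma image_of_word_subword:
  assumes f: "f \<in> bihecke_monoid W I s" and one: "f \<one> = \<one>"
    and ws: "set ws \<subseteq> I"
  shows "\<exists>us. reduced_word W I s (f (wp ws)) us \<and> subseq us ws"
  using ws
proof (induction ws)
  case Nil
  have "len \<one> = 0"
    using len_le[of "[]"] by simp
  then show ?case
    by (simp add: one reduced_word_def)
next
  case (Cons j ws)
  then obtain us where us: "set us \<subseteq> I" "wp us = f (wp ws)" "length us = len (wp us)"
      "subseq us ws"
    by (auto simp: reduced_word_def)
  have j: "j \<in> I" using Cons by simp
  have "wp ws \<in> carrier W" using Cons.prems by simp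
  then have "f (wp (j # ws)) \<in> {wp us, s j \<otimes> wp us}"
    using bihecke_left_mult[OF f] j us(2) by simp
  then consider "f (wp (j # ws)) = wp us" | "f (wp (j # ws)) = s j \<otimes> wp us"
    by blast
  then show ?case
  proof cases
    case 1
    then show ?thesis
      using us by (auto simp: reduced_word_def)
  next
    case 2
    show ?thesis
    proof (rule len_s_mult_cases[OF j word_prod_closed[OF us(1)]])
      assume "len (s j \<otimes> wp us) = Suc (len (wp us))"
      then have "reduced_word W I s (f (wp (j # ws))) (j # us)"
        using us j 2 by (simp add: reduced_word_def)
      then show ?thesis using us(4) by auto
    next
      assume less: "len (wp us) = Suc (len (s j \<otimes> wp us))"
      then obtain as k bs where *: "us = as @ k # bs" "s j \<otimes> wp us = wp (as @ bs)"
        using exchange[OF us(1,3) j] by (metis lessI)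
      have "subseq (as @ bs) us"
        using * by (auto intro: list_emb_append_mono)
      then have "subseq (as @ bs) (j # ws)"
        using us(4) subseq_order.order_trans by blast
      moreover have "reduced_word W I s (f (wp (j # ws))) (as @ bs)"
        using us(1,3) less * 2 by (auto simp: reduced_word_def)
      ultimately show ?thesis by blast
    qed
  qed
qed

end

theorem proposition3p4:
  fixes W :: "('a, 'c) monoid_scheme" and I :: "'i set" and s :: "'i \<Rightarrow> 'a"
    and f :: "'a \<Rightarrow> 'a"
  assumes "finite_coxeter_system W I s"
    and "f \<in> bihecke_monoid W I s"
    and "f \<one>\<^bsub>W\<^esub> = \<one>\<^bsub>W\<^esub>"
  shows "\<forall>w\<in>carrier W. bruhat_le W I s (f w) w"
proof
  fix w assume w: "w \<in> carrier W"
  interpret finite_coxeter_system W I s by (fact assms(1))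
  obtain ws where ws: "set ws \<subseteq> I" "wp ws = w" "length ws = len w"
    using obtain_reduced w by blast
  then have "reduced_word W I s w ws"
    by (simp add: reduced_word_def)
  moreover obtain us where "reduced_word W I s (f w) us" "subseq us ws"
    using image_of_word_subword[OF assms(2,3) ws(1)] ws(2) by auto
  ultimately show "bruhat_le W I s (f w) w"
    unfolding bruhat_le_def by blast
qed

end
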